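(* Let $R$ be a ring and let $M$ be a g-radical supplemented left $R$-module. Then for every submodule $K$ of $M$, the factor module $M/K$ is g-radical supplemented.
   Context: All rings are associative with identity and all modules are unital left modules. $N \le M$ means $N$ is a submodule of $M$. A submodule $N \le M$ is essential if $K \cap N \ne 0$ for every nonzero submodule $K$ of $M$. The generalized radical $Rad_g M$ of a module $M$ is the intersection of all maximal submodules of $M$ that are essential in $M$; if $M$ has no such submodule, $Rad_g M = M$. For $U, V \le M$, $V$ is a g-radical supplement of $U$ in $M$ if $M = U + V$ and $U \cap V \le Rad_g V$. The module $M$ is g-radical supplemented if every submodule of $M$ has a g-radical supplement in $M$. *)

theory Defs
  imports "HOL-Algebra.Module" "HOL-Algebra.AbelCoset"
begin

text \<open>
  The library locale \<^locale>\<open>module\<close> requires a commutative ring of scalars. The following is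
  the same locale over an arbitrary ring. The record type \<open>module\<close>, the locale
  \<^locale>\<open>submodule\<close> and \<^const>\<open>set_add\<close> (the sum of two submodules) do not depend on
  commutativity. A submodule \<open>N\<close> of \<open>M\<close>, regarded as a module of its own, is
  \<open>M\<lparr>carrier := N\<rparr>\<close>.
\<close>

locale left_module = R?: ring + M?: abelian_group M for M (structure) +
  assumes smult_closed [simp, intro]:
      "\<lbrakk>a \<in> carrier R; x \<in> carrier M\<rbrakk> \<Longrightarrow> a \<odot>\<^bsub>M\<^esub> x \<in> carrier M"
    and smult_l_distr:
      "\<lbrakk>a \<in> carrier R; b \<in> carrier R; x \<in> carrier M\<rbrakk> \<Longrightarrow>
        (a \<oplus> b) \<odot>\<^bsub>M\<^esub> x = a \<odot>\<^bsub>M\<^esub> x \<oplus>\<^bsub>M\<^esub> b \<odot>\<^bsub>M\<^esub> x"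
    and smult_r_distr:
      "\<lbrakk>a \<in> carrier R; x \<in> carrier M; y \<in> carrier M\<rbrakk> \<Longrightarrow>
        a \<odot>\<^bsub>M\<^esub> (x \<oplus>\<^bsub>M\<^esub> y) = a \<odot>\<^bsub>M\<^esub> x \<oplus>\<^bsub>M\<^esub> a \<odot>\<^bsub>M\<^esub> y"
    and smult_assoc1:
      "\<lbrakk>a \<in> carrier R; b \<in> carrier R; x \<in> carrier M\<rbrakk> \<Longrightarrow>
        (a \<otimes> b) \<odot>\<^bsub>M\<^esub> x = a \<odot>\<^bsub>M\<^esub> (b \<odot>\<^bsub>M\<^esub> x)"
    and smult_one [simp]:
      "x \<in> carrier M \<Longrightarrow> \<one> \<odot>\<^bsub>M\<^esub> x = x"

definition essential_submodule ::
  "'a set \<Rightarrow> ('r, 'x) ring_scheme \<Rightarrow> ('r, 'a, 'm) module_scheme \<Rightarrow> bool"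
  where "essential_submodule N R M \<longleftrightarrow>
    submodule N R M \<and>
    (\<forall>K. submodule K R M \<longrightarrow> K \<noteq> {\<zero>\<^bsub>M\<^esub>} \<longrightarrow> K \<inter> N \<noteq> {\<zero>\<^bsub>M\<^esub>})"

definition maximal_submodule ::
  "'a set \<Rightarrow> ('r, 'x) ring_scheme \<Rightarrow> ('r, 'a, 'm) module_scheme \<Rightarrow> bool"
  where "maximal_submodule N R M \<longleftrightarrow>
    submodule N R M \<and> N \<noteq> carrier M \<and>
    (\<forall>L. submodule L R M \<longrightarrow> N \<subseteq> L \<longrightarrow> L = N \<or> L = carrier M)"

definition generalized_radical ::
  "('r, 'x) ring_scheme \<Rightarrow> ('r, 'a, 'm) module_scheme \<Rightarrow> 'a set"
  where "generalized_radical R M =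
    (if \<exists>N. maximal_submodule N R M \<and> essential_submodule N R M
     then \<Inter>{N. maximal_submodule N R M \<and> essential_submodule N R M}
     else carrier M)"

text \<open>\<open>g_radical_supplement V U R M\<close>: \<open>V\<close> is a g-radical supplement of \<open>U\<close> in \<open>M\<close>.\<close>

definition g_radical_supplement ::
  "'a set \<Rightarrow> 'a set \<Rightarrow> ('r, 'x) ring_scheme \<Rightarrow> ('r, 'a, 'm) module_scheme \<Rightarrow> bool"
  where "g_radical_supplement V U R M \<longleftrightarrow>
    submodule U R M \<and> submodule V R M \<and>
    carrier M = U <+>\<^bsub>M\<^esub> V \<and>
    U \<inter> V \<subseteq> generalized_radical R (M\<lparr>carrier := V\<rparr>)"

definition g_radical_supplemented ::
  "('r, 'x) ring_scheme \<Rightarrow> ('r, 'a, 'm) module_scheme \<Rightarrow> bool"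
  where "g_radical_supplemented R M \<longleftrightarrow>
    (\<forall>U. submodule U R M \<longrightarrow> (\<exists>V. g_radical_supplement V U R M))"

text \<open>
  The factor module is built on cosets in the same way as the library's \<open>FactRing\<close>; the union in
  the scalar multiplication is the single coset \<open>K +> (r \<odot> x)\<close>, for any \<open>x \<in> X\<close>. The fields
  \<^const>\<open>mult\<close> and \<^const>\<open>one\<close>, which the module record inherits from the ring record, play no
  role for modules.
\<close>

definition factor_module ::
  "('r, 'a, 'm) module_scheme \<Rightarrow> 'a set \<Rightarrow> ('r, 'a set) module"
  where "factor_module M K =
    \<lparr>carrier = a_rcosets\<^bsub>M\<^esub> K, mult = undefined, one = undefined,
     zero = K, add = set_add M,
     smult = (\<lambda>r X. \<Union>x\<in>X. K +>\<^bsub>M\<^esub> (r \<odot>\<^bsub>M\<^esub> x))\<rparr>"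

lemma (in left_module) submodule_abelian_subgroup:
  assumes "submodule K R M"
  shows "abelian_subgroup K M"
  using assms abelian_group_axioms
  by (intro abelian_subgroupI3) (auto intro: additive_subgroupI simp: submodule_def)

lemma (in left_module) factor_module_smult:
  assumes K: "submodule K R M" and r: "r \<in> carrier R" and x: "x \<in> carrier M"
  shows "r \<odot>\<^bsub>factor_module M K\<^esub> (K +>\<^bsub>M\<^esub> x) = K +>\<^bsub>M\<^esub> (r \<odot>\<^bsub>M\<^esub> x)"
proof -
  interpret K: abelian_subgroup K M
    using K by (rule submodule_abelian_subgroup)
  have "K +>\<^bsub>M\<^esub> (r \<odot>\<^bsub>M\<^esub> y) = K +>\<^bsub>M\<^esub> (r \<odot>\<^bsub>M\<^esub> x)" if y: "y \<in> K +>\<^bsub>M\<^esub> x" for y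
  proof -
    obtain k where k: "k \<in> K" "y = k \<oplus>\<^bsub>M\<^esub> x"
      using y by (auto simp: a_r_coset_def')
    have "r \<odot>\<^bsub>M\<^esub> y = r \<odot>\<^bsub>M\<^esub> k \<oplus>\<^bsub>M\<^esub> r \<odot>\<^bsub>M\<^esub> x"
      using k r x by (simp add: smult_r_distr)
    moreover have "r \<odot>\<^bsub>M\<^esub> k \<in> K"
      using K r k(1) by (rule submodule.smult_closed)
    ultimately have "r \<odot>\<^bsub>M\<^esub> y \<in> K +>\<^bsub>M\<^esub> (r \<odot>\<^bsub>M\<^esub> x)"
      by (auto simp: a_r_coset_def')
    then show ?thesis
      using K.a_repr_independence' r x by (metis smult_closed)
  qed
  moreover have "x \<in> K +>\<^bsub>M\<^esub> x"
    using x by (rule K.a_rcos_self)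
  ultimately have "(\<Union>y\<in>K +>\<^bsub>M\<^esub> x. K +>\<^bsub>M\<^esub> (r \<odot>\<^bsub>M\<^esub> y)) = K +>\<^bsub>M\<^esub> (r \<odot>\<^bsub>M\<^esub> x)"
    by blast
  then show ?thesis
    by (simp add: factor_module_def)
qed

lemma (in left_module) factor_module_is_left_module:
  assumes K: "submodule K R M"
  shows "left_module R (factor_module M K)"
proof -
  interpret K: abelian_subgroup K M
    using K by (rule submodule_abelian_subgroup)
  let ?Q = "factor_module M K"
  have carr: "carrier ?Q = (\<lambda>x. K +>\<^bsub>M\<^esub> x) ` carrier M"
    by (auto simp: factor_module_def A_RCOSETS_def')
  have add: "(K +>\<^bsub>M\<^esub> x) \<oplus>\<^bsub>?Q\<^esub> (K +>\<^bsub>M\<^esub> y) = K +>\<^bsub>M\<^esub> (x \<oplus>\<^bsub>M\<^esub> y)"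
    if "x \<in> carrier M" "y \<in> carrier M" for x y
    using K.a_rcos_sum that by (simp add: factor_module_def)
  have zero: "\<zero>\<^bsub>?Q\<^esub> = K +>\<^bsub>M\<^esub> \<zero>\<^bsub>M\<^esub>"
    using K.a_subset by (simp add: factor_module_def)
  have "abelian_group ?Q"
  proof (rule abelian_groupI)
    fix X assume "X \<in> carrier ?Q"
    then obtain x where x: "x \<in> carrier M" "X = K +>\<^bsub>M\<^esub> x"
      by (auto simp: carr)
    then show "\<exists>Y\<in>carrier ?Q. Y \<oplus>\<^bsub>?Q\<^esub> X = \<zero>\<^bsub>?Q\<^esub>"
      by (intro bexI[of _ "K +>\<^bsub>M\<^esub> (\<ominus>\<^bsub>M\<^esub> x)"]) (auto simp: carr add zero M.l_neg)
  qed (auto simp: carr add zero M.add.m_ac)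
  then show ?thesis
    by (intro left_module.intro ring_axioms left_module_axioms.intro)
      (auto simp: carr add factor_module_smult[OF K] smult_l_distr smult_r_distr smult_assoc1)
qed

lemma (in left_module) submodule_is_left_module:
  assumes N: "submodule N R M"
  shows "left_module R (M\<lparr>carrier := N\<rparr>)"
proof -
  interpret N: abelian_subgroup N M
    using N by (rule submodule_abelian_subgroup)
  have "abelian_group (M\<lparr>carrier := N\<rparr>)"
  proof (rule abelian_groupI)
    fix x assume "x \<in> carrier (M\<lparr>carrier := N\<rparr>)"
    then show "\<exists>y\<in>carrier (M\<lparr>carrier := N\<rparr>). y \<oplus>\<^bsub>M\<lparr>carrier := N\<rparr>\<^esub> x = \<zero>\<^bsub>M\<lparr>carrier := N\<rparr>\<^esub>"
      by (intro bexI[of _ "\<ominus>\<^bsub>M\<^esub> x"]) (auto simp: M.l_neg)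
  qed (auto simp: M.add.m_ac)
  then show ?thesis
    using N by (intro left_module.intro ring_axioms left_module_axioms.intro)
      (auto simp: smult_l_distr smult_r_distr smult_assoc1 submodule.smult_closed)
qed

end

theory Submission
  imports Defs
begin

text \<open>
  If \<open>f : M \<rightarrow> N\<close> is a surjective homomorphism, the preimage of an essential maximal submodule of
  \<open>N\<close> is essential and maximal in \<open>M\<close>: a submodule \<open>L\<close> of \<open>M\<close> either lies in the kernel, hence in
  the preimage, or has a nonzero image, which meets the given submodule. Therefore \<open>f\<close> maps
  \<open>Rad\<^sub>g M\<close> into \<open>Rad\<^sub>g N\<close>. Now let \<open>U\<close> be a submodule of \<open>N\<close>. If \<open>V\<close> is a g-radical supplement of
  \<open>f\<^sup>-\<^sup>1 U\<close> in \<open>M\<close>, then \<open>N = U + f V\<close>, and \<open>U \<inter> f V = f (f\<^sup>-\<^sup>1 U \<inter> V)\<close> lies in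
  \<open>f (Rad\<^sub>g V) \<subseteq> Rad\<^sub>g (f V)\<close>. The theorem is the case \<open>N = M/K\<close>.
\<close>

lemma (in left_module) smult_l_null:
  assumes "x \<in> carrier M"
  shows "\<zero> \<odot>\<^bsub>M\<^esub> x = \<zero>\<^bsub>M\<^esub>"
proof -
  have "\<zero> \<odot>\<^bsub>M\<^esub> x \<oplus>\<^bsub>M\<^esub> \<zero> \<odot>\<^bsub>M\<^esub> x = \<zero> \<odot>\<^bsub>M\<^esub> x"
    using assms smult_l_distr[of \<zero> \<zero> x] by simp
  then show ?thesis
    using assms by (metis M.add.r_cancel_one smult_closed R.zero_closed)
qed

lemma (in left_module) smult_minus_one:
  assumes "x \<in> carrier M"
  shows "(\<ominus> \<one>) \<odot>\<^bsub>M\<^esub> x = \<ominus>\<^bsub>M\<^esub> x"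
proof -
  have "(\<ominus> \<one>) \<odot>\<^bsub>M\<^esub> x \<oplus>\<^bsub>M\<^esub> x = \<zero>\<^bsub>M\<^esub>"
    using assms smult_l_distr[of "\<ominus> \<one>" \<one> x] by (simp add: R.l_neg smult_l_null)
  then show ?thesis
    using assms by (intro M.minus_equality[symmetric]) auto
qed

text \<open>Closure under additive inverses comes from closure under scalars, because the inverse of
  \<open>x\<close> is its multiple by \<open>\<ominus> \<one>\<close>. In this form, images and
  preimages of submodules are checked with sums and scalar multiples alone.\<close>

lemma (in left_module) submodule_iff:
  "submodule H R M \<longleftrightarrow>
    H \<subseteq> carrier M \<and> \<zero>\<^bsub>M\<^esub> \<in> H \<and> (\<forall>x\<in>H. \<forall>y\<in>H. x \<oplus>\<^bsub>M\<^esub> y \<in> H) \<and>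
    (\<forall>a\<in>carrier R. \<forall>x\<in>H. a \<odot>\<^bsub>M\<^esub> x \<in> H)"
  (is "_ \<longleftrightarrow> ?closed")
proof
  assume "submodule H R M"
  then interpret H: submodule H R M .
  show ?closed
    using H.subset H.one_closed H.m_closed H.smult_closed by simp
next
  assume closed: ?closed
  have "inv\<^bsub>add_monoid M\<^esub> x \<in> H" if x: "x \<in> H" for x
  proof -
    have "(\<ominus> \<one>) \<odot>\<^bsub>M\<^esub> x \<in> H" and "x \<in> carrier M"
      using closed x by auto
    then show ?thesis
      using smult_minus_one[of x] by (metis a_inv_def)
  qed
  then show "submodule H R M"
    using closed by (simp add: submodule_def submodule_axioms_def subgroup_def)
qed

text \<open>Working with an arbitrary surjection instead of the coset map lets the same results
  apply twice: to \<open>M \<rightarrow> N\<close> and to its restriction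
  \<open>V \<rightarrow> f V\<close>.\<close>

locale left_module_epi =
  dom: left_module R M + cod: left_module R N
  for R :: "('r, 'x) ring_scheme" and M :: "('r, 'a, 'm) module_scheme"
    and N :: "('r, 'b, 'n) module_scheme" +
  fixes f :: "'a \<Rightarrow> 'b"
  assumes surj: "f ` carrier M = carrier N"
    and hom_add: "\<lbrakk>x \<in> carrier M; y \<in> carrier M\<rbrakk> \<Longrightarrow> f (x \<oplus>\<^bsub>M\<^esub> y) = f x \<oplus>\<^bsub>N\<^esub> f y"
    and hom_smult: "\<lbrakk>a \<in> carrier R; x \<in> carrier M\<rbrakk> \<Longrightarrow> f (a \<odot>\<^bsub>M\<^esub> x) = a \<odot>\<^bsub>N\<^esub> f x"
begin

lemma hom_closed: "x \<in> carrier M \<Longrightarrow> f x \<in> carrier N"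
  using surj by blast

lemma hom_zero: "f \<zero>\<^bsub>M\<^esub> = \<zero>\<^bsub>N\<^esub>"
proof -
  \<comment> \<open>Zero is its own multiple by the zero scalar, so compatibility with scalars sends
    it to a multiple by the zero scalar, which is zero.\<close>
  have "f (\<zero>\<^bsub>R\<^esub> \<odot>\<^bsub>M\<^esub> \<zero>\<^bsub>M\<^esub>) = \<zero>\<^bsub>R\<^esub> \<odot>\<^bsub>N\<^esub> f \<zero>\<^bsub>M\<^esub>"
    by (intro hom_smult) auto
  then show ?thesis
    by (simp add: dom.smult_l_null cod.smult_l_null hom_closed)
qed

lemma hom_minus:
  assumes "x \<in> carrier M" "y \<in> carrier M"
  shows "f (x \<ominus>\<^bsub>M\<^esub> y) = f x \<ominus>\<^bsub>N\<^esub> f y"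
  using assms hom_add[of x "\<ominus>\<^bsub>M\<^esub> y"] hom_smult[of "\<ominus>\<^bsub>R\<^esub> \<one>\<^bsub>R\<^esub>" y]
  by (simp add: dom.smult_minus_one cod.smult_minus_one hom_closed a_minus_def)

lemma submodule_vimage:
  assumes "submodule L R N"
  shows "submodule {x \<in> carrier M. f x \<in> L} R M"
  using assms by (auto simp: dom.submodule_iff cod.submodule_iff hom_zero hom_add hom_smult)

lemma submodule_image:
  assumes L: "submodule L R M"
  shows "submodule (f ` L) R N"
proof -
  have sub: "L \<subseteq> carrier M" and zero: "\<zero>\<^bsub>M\<^esub> \<in> L"
    using L by (auto simp: dom.submodule_iff)
  have "f x \<oplus>\<^bsub>N\<^esub> f y \<in> f ` L" if "x \<in> L" "y \<in> L" for x y
    using that sub L hom_add[of x y, symmetric] by (auto simp: dom.submodule_iff subset_iff)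
  moreover have "a \<odot>\<^bsub>N\<^esub> f x \<in> f ` L" if "a \<in> carrier R" "x \<in> L" for a x
    using that sub L hom_smult[of a x, symmetric] by (auto simp: dom.submodule_iff subset_iff)
  moreover have "\<zero>\<^bsub>N\<^esub> \<in> f ` L"
    using zero hom_zero by (metis imageI)
  ultimately show ?thesis
    using sub by (auto simp: cod.submodule_iff hom_closed)
qed

text \<open>The condition on a g-radical supplement \<open>V\<close> concerns the radical of
  \<open>V\<close> as a module of its own. To carry this condition over to \<open>f V\<close>, the
  restricted map must itself be a surjective homomorphism.\<close>

lemma left_module_epi_restrict:
  assumes V: "submodule V R M"
  shows "left_module_epi R (M\<lparr>carrier := V\<rparr>) (N\<lparr>carrier := f ` V\<rparr>) f"
proof -
  have "V \<subseteq> carrier M"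
    using V by (simp add: dom.submodule_iff)
  then show ?thesis
    using dom.submodule_is_left_module[OF V] cod.submodule_is_left_module[OF submodule_image[OF V]]
    by (auto simp: left_module_epi_def left_module_epi_axioms_def hom_add hom_smult subset_iff)
qed

text \<open>A submodule \<open>L\<close> containing the preimage of \<open>P\<close> also contains
  the kernel, so it is determined by its image. This image contains \<open>P\<close>, and maximality
  of \<open>P\<close> leaves two cases.\<close>

lemma maximal_submodule_vimage:
  assumes P: "maximal_submodule P R N"
  shows "maximal_submodule {x \<in> carrier M. f x \<in> P} R M" (is "maximal_submodule ?Q R M")
  unfolding maximal_submodule_def
proof (intro conjI allI impI)
  have P_sub: "submodule P R N" and P_proper: "P \<noteq> carrier N"
    using P by (auto simp: maximal_submodule_def)
  show "submodule ?Q R M"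
    using P_sub by (rule submodule_vimage)
  show "?Q \<noteq> carrier M"
  proof
    assume "?Q = carrier M"
    then have "f ` carrier M \<subseteq> P" by blast
    then show False
      using P_sub P_proper surj by (simp add: cod.submodule_iff subset_antisym)
  qed
  fix L assume L: "submodule L R M" and "?Q \<subseteq> L"
  then have L_sub: "L \<subseteq> carrier M" by (simp add: dom.submodule_iff)
  \<comment> \<open>Surjectivity enters here: each element of \<open>P\<close> has a preimage, which
    lies in \<open>?Q\<close> and therefore in \<open>L\<close>.\<close>
  have "P \<subseteq> f ` L"
  proof
    fix p assume p: "p \<in> P"
    then have "p \<in> f ` carrier M"
      using P_sub surj by (auto simp: cod.submodule_iff)
    then obtain x where "x \<in> carrier M" "p = f x" by blast
    then show "p \<in> f ` L"
      using p \<open>?Q \<subseteq> L\<close> by auto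
  qed
  then consider "f ` L = P" | "f ` L = carrier N"
    using P submodule_image[OF L] by (auto simp: maximal_submodule_def)
  then show "L = ?Q \<or> L = carrier M"
  proof cases
    case 1
    then show ?thesis
      using \<open>?Q \<subseteq> L\<close> L_sub by auto
  next
    case 2
    have "x \<in> L" if x: "x \<in> carrier M" for x
    proof -
      \<comment> \<open>Since \<open>f L\<close> is all of \<open>N\<close>, some \<open>l\<close>
        in \<open>L\<close> has the same image as \<open>x\<close>. The difference of
        \<open>x\<close> and \<open>l\<close> is in the kernel, hence in \<open>?Q\<close> and in
        \<open>L\<close>; adding \<open>l\<close> back gives \<open>x\<close>.\<close>
      obtain l where l: "l \<in> L" "f x = f l"
        using 2 hom_closed[OF x] by (metis imageE)
      then have l_carr: "l \<in> carrier M"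
        using L_sub by auto
      have "f (x \<ominus>\<^bsub>M\<^esub> l) = \<zero>\<^bsub>N\<^esub>"
        using x l l_carr by (simp add: hom_minus hom_closed a_minus_def[of N] cod.M.r_neg)
      then have "x \<ominus>\<^bsub>M\<^esub> l \<in> ?Q"
        using x l_carr P_sub by (simp add: cod.submodule_iff)
      then have "(x \<ominus>\<^bsub>M\<^esub> l) \<oplus>\<^bsub>M\<^esub> l \<in> L"
        using \<open>?Q \<subseteq> L\<close> l L unfolding dom.submodule_iff by blast
      then show ?thesis
        using x l_carr by (simp add: a_minus_def dom.M.a_assoc dom.M.l_neg)
    qed
    then show ?thesis
      using L_sub by auto
  qed
qed

lemma essential_submodule_vimage:
  assumes P: "essential_submodule P R N"
  shows "essential_submodule {x \<in> carrier M. f x \<in> P} R M" (is "essential_submodule ?Q R M")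
  unfolding essential_submodule_def
proof (intro conjI allI impI)
  have P_sub: "submodule P R N"
    using P by (simp add: essential_submodule_def)
  show "submodule ?Q R M"
    using P_sub by (rule submodule_vimage)
  fix L assume L: "submodule L R M" and nz: "L \<noteq> {\<zero>\<^bsub>M\<^esub>}"
  then have L_sub: "L \<subseteq> carrier M" by (simp add: dom.submodule_iff)
  show "L \<inter> ?Q \<noteq> {\<zero>\<^bsub>M\<^esub>}"
  proof (cases "f ` L = {\<zero>\<^bsub>N\<^esub>}")
    \<comment> \<open>Here \<open>L\<close> lies in the kernel, so \<open>L \<inter> ?Q\<close> is
      \<open>L\<close> itself, which is nonzero by assumption.\<close>
    case True
    moreover have "\<zero>\<^bsub>N\<^esub> \<in> P"
      using P_sub by (simp add: cod.submodule_iff)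
    ultimately have "f x \<in> P" if "x \<in> L" for x
      using that by (metis imageI singletonD)
    then show ?thesis
      using L_sub nz by (simp add: Int_absorb2 subset_iff)
  next
    case False
    then have "f ` L \<inter> P \<noteq> {\<zero>\<^bsub>N\<^esub>}"
      using P submodule_image[OF L] by (simp add: essential_submodule_def)
    \<comment> \<open>Being different from the zero submodule would also hold for the empty set. As
      the intersection contains zero, it must have a nonzero element as well.\<close>
    moreover have "\<zero>\<^bsub>N\<^esub> \<in> f ` L \<inter> P"
      using submodule_image[OF L] P_sub by (simp add: cod.submodule_iff)
    ultimately obtain x where "x \<in> L" "f x \<in> P" "f x \<noteq> \<zero>\<^bsub>N\<^esub>"
      by blast
    then have "x \<in> L \<inter> ?Q" and "x \<noteq> \<zero>\<^bsub>M\<^esub>"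
      using L_sub hom_zero by auto
    then show ?thesis by blast
  qed
qed

text \<open>An element of the radical of \<open>M\<close> lies in every essential maximal submodule
  of \<open>M\<close>, in particular in the preimage of each such submodule \<open>P\<close> of
  \<open>N\<close>; so its image lies in \<open>P\<close>.\<close>

lemma image_generalized_radical:
  "f ` generalized_radical R M \<subseteq> generalized_radical R N"
proof (cases "\<exists>P. maximal_submodule P R N \<and> essential_submodule P R N")
  case True
  have "f x \<in> P" if x: "x \<in> generalized_radical R M"
    and "maximal_submodule P R N" "essential_submodule P R N" for x P
  proof -
    have "maximal_submodule {x \<in> carrier M. f x \<in> P} R M"
      and "essential_submodule {x \<in> carrier M. f x \<in> P} R M"
      using that by (auto intro: maximal_submodule_vimage essential_submodule_vimage)
    \<comment> \<open>The preimage of \<open>P\<close> witnesses that the radical of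
      \<open>M\<close> is a genuine intersection, and it is one of the submodules
      intersected.\<close>
    then have "x \<in> {x \<in> carrier M. f x \<in> P}"
      using x unfolding generalized_radical_def by (metis (mono_tags, lifting) InterD mem_Collect_eq)
    then show ?thesis by simp
  qed
  then show ?thesis
    using True by (auto simp: generalized_radical_def[of R N])
next
  case False
  \<comment> \<open>With no essential maximal submodule in \<open>N\<close>, the radical of
    \<open>N\<close> is all of \<open>N\<close>. It is enough that the radical of \<open>M\<close>
    lies in \<open>M\<close>, whichever branch of its definition applies.\<close>
  have "generalized_radical R M \<subseteq> carrier M"
    by (auto simp: generalized_radical_def maximal_submodule_def dom.submodule_iff)
  then show ?thesis
    unfolding generalized_radical_def[of R N] using False hom_closed by auto
qed

lemma g_radical_supplement_image:
  assumes U: "submodule U R N"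
    and V: "g_radical_supplement V {x \<in> carrier M. f x \<in> U} R M"
  shows "g_radical_supplement (f ` V) U R N"
  unfolding g_radical_supplement_def
proof (intro conjI)
  have V_submodule: "submodule V R M"
    and sum: "carrier M = {x \<in> carrier M. f x \<in> U} <+>\<^bsub>M\<^esub> V"
    and rad: "{x \<in> carrier M. f x \<in> U} \<inter> V \<subseteq> generalized_radical R (M\<lparr>carrier := V\<rparr>)"
    using V by (auto simp: g_radical_supplement_def)
  have V_sub: "V \<subseteq> carrier M" and U_sub: "U \<subseteq> carrier N"
    using V_submodule U by (auto simp: dom.submodule_iff cod.submodule_iff)
  show "submodule U R N" by (rule U)
  show "submodule (f ` V) R N"
    using V_submodule by (rule submodule_image)
  show "carrier N = U <+>\<^bsub>N\<^esub> f ` V"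
  proof
    show "carrier N \<subseteq> U <+>\<^bsub>N\<^esub> f ` V"
    proof
      fix y assume "y \<in> carrier N"
      then obtain x where "x \<in> carrier M" "y = f x"
        using surj by auto
      \<comment> \<open>A preimage of \<open>y\<close> is split in \<open>M\<close>; applying
        \<open>f\<close> to the two summands splits \<open>y\<close> into an element of
        \<open>U\<close> and one of \<open>f V\<close>.\<close>
      then obtain u v where "u \<in> carrier M" "f u \<in> U" "v \<in> V" "x = u \<oplus>\<^bsub>M\<^esub> v"
        using sum unfolding set_add_def' by blast
      then show "y \<in> U <+>\<^bsub>N\<^esub> f ` V"
        using V_sub \<open>y = f x\<close> by (auto simp: set_add_def' hom_add subset_iff)
    qed
    show "U <+>\<^bsub>N\<^esub> f ` V \<subseteq> carrier N"
      using U_sub V_sub by (auto simp: set_add_def' hom_closed subset_iff)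
  qed
  interpret V: left_module_epi R "M\<lparr>carrier := V\<rparr>" "N\<lparr>carrier := f ` V\<rparr>" f
    using V_submodule by (rule left_module_epi_restrict)
  \<comment> \<open>An element of \<open>U\<close> of the form \<open>f v\<close> with
    \<open>v\<close> in \<open>V\<close> comes from the preimage of \<open>U\<close>, since
    \<open>v\<close> itself lies there.\<close>
  have "U \<inter> f ` V \<subseteq> f ` ({x \<in> carrier M. f x \<in> U} \<inter> V)"
    using V_sub by auto
  also have "\<dots> \<subseteq> f ` generalized_radical R (M\<lparr>carrier := V\<rparr>)"
    using rad by (rule image_mono)
  also have "\<dots> \<subseteq> generalized_radical R (N\<lparr>carrier := f ` V\<rparr>)"
    by (rule V.image_generalized_radical)
  finally show "U \<inter> f ` V \<subseteq> generalized_radical R (N\<lparr>carrier := f ` V\<rparr>)" .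
qed

lemma g_radical_supplemented_image:
  assumes "g_radical_supplemented R M"
  shows "g_radical_supplemented R N"
  using assms submodule_vimage g_radical_supplement_image
  unfolding g_radical_supplemented_def by blast

end

text \<open>The coset map is onto because every element of the factor module is a coset of some
  \<open>x\<close>; it respects the operations because those on cosets can be computed on
  representatives.\<close>

lemma (in left_module) left_module_epi_factor_module:
  assumes K: "submodule K R M"
  shows "left_module_epi R M (factor_module M K) (\<lambda>x. K +>\<^bsub>M\<^esub> x)"
proof -
  interpret K: abelian_subgroup K M
    using K by (rule submodule_abelian_subgroup)
  show ?thesis
    using left_module_axioms factor_module_is_left_module[OF K] factor_module_smult[OF K]
    by (auto simp: left_module_epi_def left_module_epi_axioms_def factor_module_def
        A_RCOSETS_def' K.a_rcos_sum)
qed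

theorem lemma2p7:
  fixes R :: "('r, 'x) ring_scheme" and M :: "('r, 'a, 'm) module_scheme"
  assumes "left_module R M"
    and "g_radical_supplemented R M"
    and "submodule K R M"
  shows "g_radical_supplemented R (factor_module M K)"
  using left_module_epi.g_radical_supplemented_image[OF
      left_module.left_module_epi_factor_module[OF assms(1,3)] assms(2)] .

end
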